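(* For all non-negative integers $n, k \ge 0$, \[ \sum_{\ell=0}^n (-1)^\ell\, \mathscr{B}_{n-\ell}^{(-\ell)}(k) = k!\cdot (-1)^{n/2}\, G_n(1,1,k), \] where $\mathscr{B}_m^{(-\ell)}(k)$ denotes the symmetrized poly-Bernoulli number and $G_n(x,y,z)$ the $n$-th Dumont-Foata polynomial. In particular, both sides equal zero for odd $n$ (where $G_n = 0$ by definition).
   Context: **Poly-Bernoulli polynomials.** For $\ell \in \mathbb{Z}$, the polylogarithm is $\mathrm{Li}_\ell(z) = \sum_{m=1}^\infty \frac{z^m}{m^\ell}$ ($|z|<1$). The poly-Bernoulli polynomials $B_m^{(\ell)}(x)$ ($m \ge 0$) of index $\ell$ are defined by the generating series \[ e^{-xt}\,\frac{\mathrm{Li}_\ell(1-e^{-t})}{1-e^{-t}} = \sum_{m=0}^\infty B_m^{(\ell)}(x)\frac{t^m}{m!}. \] **Symmetrized poly-Bernoulli numbers.** For integers $m, \ell, k \ge 0$, define \[ \mathscr{B}_m^{(-\ell)}(k) = \sum_{j=0}^k \left[{k \atop j}\right] B_m^{(-\ell-j)}(k), \] where $\left[{k \atop j}\right]$ is the (unsigned) Stirling number of the first kind, i.e. the number of permutations of $k$ elements with exactly $j$ cycles (with $\left[{0 \atop 0}\right]=1$). **Dumont-Foata polynomials.** Let $n$ be a positive even integer. A (surjective) pistol of size $n$ is a surjective map $p:\{1,2,\dots,n\}\to\{2,4,\dots,n\}$ with $p(x)\ge x$ for every $x \in \{1,\dots,n\}$. Let $\mathcal{P}_n$ be the set of all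 pistols of size $n$. For $p\in\mathcal{P}_n$: - $x\in\{1,\dots,n\}$ is a bulging point of $p$ if $p(y)<p(x)$ for every integer $y$ with $0<y<x$ (so $x=1$ is always a bulging point); $b(p)$ is the number of bulging points; - $x\in\{1,\dots,n\}$ is a fixed point of $p$ if $p(x)=x$; $f(p)$ is the number of fixed points; - $x\in\{1,\dots,n-1\}$ is a maximal point of $p$ if $p(x)=n$; $m(p)$ is the number of maximal points. For $n$ positive and even, the $n$-th Dumont-Foata polynomial is \[ G_n(x,y,z) := \sum_{p\in\mathcal{P}_n} x^{b(p)}y^{f(p)}z^{m(p)}. \] In addition, $G_0(x,y,z)=1$, and $G_n(x,y,z)=0$ for every positive odd integer $n$ (so for odd $n$ the expression $(-1)^{n/2}G_n(1,1,k)$ is $0$). *)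

theory Defs
  imports
    "HOL-Computational_Algebra.Formal_Power_Series"
    "HOL-Combinatorics.Stirling"
    "HOL-Library.FuncSet"
begin

text \<open>
  The polylogarithm is represented by its Taylor series at 0, a formal power series without
  constant term.
\<close>

definition fps_polylog :: "int \<Rightarrow> real fps" where
  "fps_polylog l = Abs_fps (\<lambda>m. if m = 0 then 0 else 1 / (of_nat m powi l))"

text \<open>
  The series \<open>1 - exp (-t)\<close> has subdegree 1, so the composition is the genuine substitution of
  power series, and the quotient is exact because the numerator has no constant term either.
\<close>

definition poly_bernoulli_fps :: "int \<Rightarrow> real \<Rightarrow> real fps" where
  "poly_bernoulli_fps l x =
     fps_exp (- x) * ((fps_polylog l oo (1 - fps_exp (-1))) / (1 - fps_exp (-1)))"

text \<open>\<open>poly_bernoulli m l x\<close> is the value at \<open>x\<close> of the \<open>m\<close>-th polynomial of index \<open>l\<close>.\<close>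

definition poly_bernoulli :: "nat \<Rightarrow> int \<Rightarrow> real \<Rightarrow> real" where
  "poly_bernoulli m l x = fact m * fps_nth (poly_bernoulli_fps l x) m"

text \<open>The argument \<open>l\<close> is a natural number and stands for the (upper) index \<open>-l\<close>.\<close>

definition sym_poly_bernoulli :: "nat \<Rightarrow> nat \<Rightarrow> nat \<Rightarrow> real" where
  "sym_poly_bernoulli m l k =
     (\<Sum>j\<le>k. of_nat (stirling k j) * poly_bernoulli m (- int l - int j) (of_nat k))"

text \<open>Pistols are extensional functions, so that each map on \<open>{1..n}\<close> is counted once.\<close>

definition pistols :: "nat \<Rightarrow> (nat \<Rightarrow> nat) set" where
  "pistols n = {p \<in> {1..n} \<rightarrow>\<^sub>E {v \<in> {1..n}. even v}.
     p ` {1..n} = {v \<in> {1..n}. even v} \<and> (\<forall>x\<in>{1..n}. x \<le> p x)}"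

definition bulging_points :: "nat \<Rightarrow> (nat \<Rightarrow> nat) \<Rightarrow> nat set" where
  "bulging_points n p = {x \<in> {1..n}. \<forall>y. 0 < y \<and> y < x \<longrightarrow> p y < p x}"

definition fixed_points :: "nat \<Rightarrow> (nat \<Rightarrow> nat) \<Rightarrow> nat set" where
  "fixed_points n p = {x \<in> {1..n}. p x = x}"

definition maximal_points :: "nat \<Rightarrow> (nat \<Rightarrow> nat) \<Rightarrow> nat set" where
  "maximal_points n p = {x \<in> {1..<n}. p x = n}"

definition dumont_foata :: "nat \<Rightarrow> 'a \<Rightarrow> 'a \<Rightarrow> 'a \<Rightarrow> 'a::comm_ring_1" where
  "dumont_foata n x y z =
     (if n = 0 then 1
      else if odd n then 0
      else \<Sum>p\<in>pistols n.
        x ^ card (bulging_points n p) * y ^ card (fixed_points n p) * z ^ card (maximal_points n p))"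

end

theory Submission
  imports Defs
begin

text \<open>
  Both sides, divided by \<open>k!\<close>, satisfy the same two-step recurrence in \<open>n\<close>, in which the value
  at \<open>k\<close> comes from values at \<open>k\<close> and \<open>k + 1\<close>:
  \<open>F (n + 2) k = - k ((k + 1) F n (k + 1) - k F n k)\<close>, with \<open>F 0 = 1\<close> and \<open>F 1 = 0\<close>.

  On the arithmetic side everything rests on the closed formula (\<open>sym_poly_bernoulli_eq\<close>)
  \<open>k! \<Sum>\<^sub>j C(k + j, j) j!\<^sup>2 S(l + 1, j + 1) S(m + 1, j + 1)\<close>
  for the symmetrized numbers, where \<open>S\<close> are the Stirling numbers of the second kind. To obtain it,
  put \<open>w = 1 - exp (-t)\<close>. Summation against the Stirling numbers of the first kind turns the powers
  \<open>(a + 1)^(l + j)\<close> of the polylogarithm series into \<open>(a + 1)^l\<close> times a rising factorial, that is,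
  into \<open>k! C(a + k, k) (a + 1)^l\<close>. Expanding \<open>(a + 1)^l\<close> in binomial coefficients makes
  the series in \<open>w\<close> a combination of \<open>w^j / (1 - w)^(k + j + 1)\<close>. The factor
  \<open>exp (-k t) = (1 - w)^k\<close> cancels the dependence on \<open>k\<close> of the exponent, and
  \<open>w / (1 - w) = exp t - 1\<close> leaves \<open>exp t (exp t - 1)^j\<close>, the exponential generating function of
  \<open>j! S(m + 1, j + 1)\<close>.

  In the alternating sum over \<open>l\<close> the two Stirling factors are convolved. As
  \<open>\<Sum>\<^sub>n S(n + 1, j + 1) t^n = t^j / ((1 - t) \<dots> (1 - (j + 1) t))\<close>, multiplying this series by its
  reflection under \<open>t \<mapsto> - t\<close> gives a series in \<open>t\<^sup>2\<close>, whence the recurrence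
  \<open>Stirling_conv_Suc_Suc\<close>, and with it the recurrence \<open>alt_sum_Suc_Suc\<close> for the whole sum.

  On the combinatorial side, at \<open>x = y = 1\<close> only the maximal points matter. Capping the values
  of a pistol of size \<open>n + 2\<close> at \<open>n\<close> yields a pistol \<open>q\<close> of size \<open>n\<close>; the points that
  had the value \<open>n + 2\<close> form a subset of the fiber of \<open>q\<close> over \<open>n\<close>, and surjectivity says exactly that
  this subset is proper. Summing over proper subsets, as a difference of a binomial
  expansion and its top term, gives \<open>dumont_foata_Suc_Suc\<close>.
\<close>

section \<open>Powers in the basis of binomial coefficients\<close>

text \<open>
  This is \<open>x^(l + 1) = \<Sum>\<^sub>j S(l + 1, j + 1) x (x - 1) \<dots> (x - j)\<close> at \<open>x = a + 1\<close>, with one factor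
  \<open>a + 1\<close> cancelled; hence the shifted arguments of the Stirling numbers.
\<close>

lemma Suc_power_eq_sum_Stirling_binomial:
  "Suc a ^ l = (\<Sum>j\<le>l. Stirling (Suc l) (Suc j) * fact j * (a choose j))"
proof (induction l)
  case 0
  show ?case by simp
next
  case (Suc l)
  have absorb: "Suc a * (a choose j) = Suc j * (a choose j) + Suc j * (a choose Suc j)" for j
    using Suc_times_binomial_eq[of a j] by (simp add: algebra_simps)
  have "Suc a ^ Suc l = (\<Sum>j\<le>l. Stirling (Suc l) (Suc j) * fact j * (Suc a * (a choose j)))"
    unfolding power_Suc Suc.IH by (simp add: sum_distrib_left ac_simps del: Stirling.simps mult_Suc)
  also have "\<dots> = (\<Sum>j\<le>l. Suc j * Stirling (Suc l) (Suc j) * fact j * (a choose j))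
      + (\<Sum>j\<le>l. Stirling (Suc l) (Suc j) * fact (Suc j) * (a choose Suc j))"
    unfolding absorb by (simp add: algebra_simps sum.distrib del: Stirling.simps)
  also have "(\<Sum>j\<le>l. Suc j * Stirling (Suc l) (Suc j) * fact j * (a choose j))
      = (\<Sum>j\<le>Suc l. Suc j * Stirling (Suc l) (Suc j) * fact j * (a choose j))"
    by simp
  also have "(\<Sum>j\<le>l. Stirling (Suc l) (Suc j) * fact (Suc j) * (a choose Suc j))
      = (\<Sum>j\<le>Suc l. Stirling (Suc l) j * fact j * (a choose j))"
    by (subst sum.atMost_Suc_shift) simp
  finally show ?case
    by (simp only: sum.distrib[symmetric] Stirling.simps(4)[of "Suc l"] add_mult_distrib)
qed

text \<open>
  After the expansion of \<open>(a + 1)^l\<close>, the product \<open>C(a + k, k) C(a, j)\<close> equals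
  \<open>C(k + j, j) C(a + k, k + j)\<close>, which is \<open>C(k + j, j)\<close> times a coefficient of
  \<open>X^j / (1 - X)^(k + j + 1)\<close>.
\<close>

lemma fps_binomial_mult_power_eq_sum:
  "Abs_fps (\<lambda>a. of_nat ((a + k) choose k) * of_nat (Suc a) ^ l) =
     (\<Sum>j\<le>l. fps_const (of_nat (Stirling (Suc l) (Suc j) * fact j * ((k + j) choose j))) *
        (fps_X ^ j * inverse ((1 - fps_X) ^ Suc (k + j))) :: 'a::field_char_0 fps)"
proof (rule fps_ext)
  fix a
  have inv: "inverse ((1 - fps_X :: 'a fps) ^ Suc r) = Abs_fps (\<lambda>n. of_nat ((r + n) choose n))" for r
    using one_minus_const_fps_X_neg_power'[of "Suc r" "1::'a"] by simp
  have shift: "fps_nth (fps_X ^ j * inverse ((1 - fps_X) ^ Suc (k + j)) :: 'a fps) a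
      = of_nat ((a + k) choose (k + j))" for j
  proof (cases "a < j")
    case False
    then have "(k + j + (a - j)) choose (a - j) = (a + k) choose (k + j)"
      by (subst binomial_symmetric) (auto simp: add.commute)
    with False show ?thesis
      by (simp add: inv fps_X_power_mult_nth del: power_Suc)
  qed (simp add: fps_X_power_mult_nth)
  have trinomial: "((a + k) choose k) * (a choose j) = ((k + j) choose j) * ((a + k) choose (k + j))" for j
  proof (cases "j \<le> a")
    case True
    then show ?thesis
      using choose_mult[of k "k + j" "a + k"] binomial_symmetric[of j "k + j"]
      by (simp add: ac_simps)
  qed (simp add: binomial_eq_0)
  have "((a + k) choose k) * Suc a ^ l
      = (\<Sum>j\<le>l. Stirling (Suc l) (Suc j) * fact j * (((a + k) choose k) * (a choose j)))"
    unfolding Suc_power_eq_sum_Stirling_binomial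
    by (simp add: sum_distrib_left ac_simps del: Stirling.simps)
  also have "\<dots> = (\<Sum>j\<le>l. (Stirling (Suc l) (Suc j) * fact j * ((k + j) choose j)) *
        ((a + k) choose (k + j)))"
    unfolding trinomial by (simp only: ac_simps)
  finally have "(of_nat (((a + k) choose k) * Suc a ^ l) :: 'a) = of_nat \<dots>"
    by (rule arg_cong)
  then show "fps_nth (Abs_fps (\<lambda>a. of_nat ((a + k) choose k) * of_nat (Suc a) ^ l)) a
    = fps_nth (\<Sum>j\<le>l. fps_const (of_nat (Stirling (Suc l) (Suc j) * fact j * ((k + j) choose j))) *
        (fps_X ^ j * inverse ((1 - fps_X) ^ Suc (k + j))) :: 'a fps) a"
    unfolding fps_sum_nth fps_mult_left_const_nth shift
    by (simp del: Stirling.simps of_nat_Suc)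
qed

section \<open>The closed formula for the symmetrized numbers\<close>

text \<open>
  With \<open>E\<^sub>j = exp t (exp t - 1)^j\<close>, differentiation gives \<open>E\<^sub>j' = (j + 1) E\<^sub>j + j E\<^sub>j\<^sub>-\<^sub>1\<close>, which on
  coefficients is the recurrence of the Stirling numbers of the second kind.
\<close>

lemma fps_exp_times_exp_minus_one_power_nth:
  "fact m * fps_nth (fps_exp 1 * (fps_exp 1 - 1) ^ j) m
     = (fact j * of_nat (Stirling (Suc m) (Suc j)) :: 'a::field_char_0)"
proof (induction m arbitrary: j)
  case 0
  show ?case by (cases j) auto
next
  case (Suc m)
  let ?E = "\<lambda>j. fps_exp 1 * (fps_exp 1 - 1) ^ j :: 'a fps"
  have step: "fact (Suc m) * fps_nth f (Suc m) = fact m * fps_nth (fps_deriv f) m" for f :: "'a fps"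
    by (simp add: algebra_simps)
  show ?case
  proof (cases j)
    case 0
    then show ?thesis using step[of "?E 0"] Suc.IH[of 0] by simp
  next
    case (Suc i)
    have "fps_deriv ((fps_exp 1 - 1) ^ Suc i) = of_nat (Suc i) * ?E i"
      by (simp add: fps_deriv_power' ac_simps del: power_Suc of_nat_Suc)
    moreover have "fps_deriv (?E (Suc i)) = ?E (Suc i) + fps_exp 1 * fps_deriv ((fps_exp 1 - 1) ^ Suc i)"
      by (simp add: ac_simps del: power_Suc)
    ultimately have deriv: "fps_deriv (?E (Suc i)) = of_nat (Suc (Suc i)) * ?E (Suc i) + of_nat (Suc i) * ?E i"
      by (simp add: algebra_simps)
    have "fact m * fps_nth (fps_deriv (?E (Suc i))) m
      = of_nat (Suc (Suc i)) * (fact m * fps_nth (?E (Suc i)) m)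
        + of_nat (Suc i) * (fact m * fps_nth (?E i) m)"
      unfolding deriv fps_of_nat[symmetric] fps_add_nth fps_mult_left_const_nth
      by (simp only: distrib_left ac_simps)
    also have "\<dots> = fact (Suc i) * of_nat (Stirling (Suc (Suc m)) (Suc (Suc i)))"
      unfolding Suc.IH Stirling.simps(4)[of "Suc m"] by (simp add: algebra_simps del: Stirling.simps)
    finally show ?thesis unfolding Suc step .
  qed
qed

text \<open>
  For a nonpositive index the polylogarithm is \<open>\<Sum>\<^sub>m m^l w^m\<close>; dividing by \<open>w\<close> shifts the summation
  to \<open>a = m - 1\<close>, which removes the quotient.
\<close>

lemma poly_bernoulli_fps_nonpos:
  "poly_bernoulli_fps (- int l) x =
     fps_exp (- x) * (Abs_fps (\<lambda>a. of_nat (Suc a) ^ l) oo (1 - fps_exp (- 1)))"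
proof -
  let ?w = "1 - fps_exp (- 1) :: real fps"
  have "fps_polylog (- int l) = fps_X * Abs_fps (\<lambda>a. of_nat (Suc a) ^ l)"
    by (rule fps_ext) (auto simp: fps_polylog_def power_int_minus divide_inverse gr0_conv_Suc)
  then have "fps_polylog (- int l) oo ?w = (Abs_fps (\<lambda>a. of_nat (Suc a) ^ l) oo ?w) * ?w"
    by (simp add: fps_compose_mult_distrib mult.commute)
  moreover have "fps_nth ?w 1 \<noteq> 0" by simp
  then have "?w \<noteq> 0" by (metis fps_zero_nth)
  ultimately show ?thesis
    by (simp add: poly_bernoulli_fps_def)
qed

text \<open>
  With \<open>w = 1 - exp (-t)\<close> one has \<open>1 - w = exp (-t)\<close>, so the left-hand side is
  \<open>w^j exp ((j + 1) t)\<close>, and \<open>exp t * w = exp t - 1\<close>.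
\<close>

lemma fps_exp_mult_compose_summand:
  "fps_exp (- of_nat k) *
      ((fps_X ^ j * inverse ((1 - fps_X) ^ Suc (k + j))) oo (1 - fps_exp (- 1)))
   = (fps_exp 1 * (fps_exp 1 - 1) ^ j :: 'a::field_char_0 fps)"
proof -
  let ?w = "1 - fps_exp (- 1) :: 'a fps"
  let ?r = "Suc (k + j)"
  have w0: "fps_nth ?w 0 = 0" by simp
  have "inverse ((1 - fps_X) ^ ?r) oo ?w = inverse ((1 - ?w) ^ ?r)"
    using w0 by (simp add: fps_inverse_compose fps_compose_power[symmetric] fps_compose_sub_distrib
        del: power_Suc)
  also have "\<dots> = fps_exp (of_nat ?r)"
    by (simp add: fps_exp_power_mult fps_exp_neg[symmetric] del: power_Suc of_nat_Suc)
  finally have "(fps_X ^ j * inverse ((1 - fps_X) ^ ?r)) oo ?w = ?w ^ j * fps_exp (of_nat ?r)"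
    using w0 by (simp add: fps_compose_mult_distrib fps_compose_power[symmetric] del: power_Suc)
  moreover have "fps_exp (- of_nat k) * fps_exp (of_nat ?r) = fps_exp 1 * (fps_exp 1 :: 'a fps) ^ j"
    by (simp add: fps_exp_power_mult fps_exp_add_mult[symmetric])
  moreover have "fps_exp 1 * ?w = fps_exp 1 - 1"
    by (simp add: right_diff_distrib fps_exp_add_mult[symmetric])
  then have "(fps_exp 1 :: 'a fps) ^ j * ?w ^ j = (fps_exp 1 - 1) ^ j"
    by (simp only: power_mult_distrib[symmetric])
  ultimately show ?thesis
    by (metis (no_types, lifting) mult.assoc mult.commute)
qed

text \<open>
  The coefficient, up to \<open>k!\<close>, of the product of Stirling numbers with lower index \<open>j + 1\<close> in the
  closed formula below. It equals \<open>j! (k + 1) (k + 2) \<dots> (k + j)\<close>, a polynomial in \<open>k\<close>.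
\<close>

definition weight :: "nat \<Rightarrow> nat \<Rightarrow> real" where
  "weight k j = of_nat ((k + j) choose j) * (fact j)\<^sup>2"

lemma pochhammer_Suc_eq_fact_binomial:
  "pochhammer (of_nat (Suc a)) k = (fact k * of_nat ((a + k) choose k) :: 'a::field_char_0)"
proof -
  have "fact (a + k) = (fact a * pochhammer (of_nat (Suc a)) k :: 'a)"
    using pochhammer_product'[of "1::'a" a k] by (simp add: pochhammer_fact)
  then show ?thesis
    by (simp add: binomial_fact field_simps)
qed

text \<open>
  The right-hand side is symmetric in \<open>l\<close> and \<open>m\<close>, since the summands with \<open>j > m\<close> vanish; this is
  the symmetry after which the numbers are called symmetrized.
\<close>

lemma sym_poly_bernoulli_eq:
  "sym_poly_bernoulli m l k = fact k *
     (\<Sum>j\<le>l. weight k j * of_nat (Stirling (Suc l) (Suc j)) * of_nat (Stirling (Suc m) (Suc j)))"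
proof -
  let ?w = "1 - fps_exp (- 1) :: real fps"
  let ?A = "\<lambda>l. Abs_fps (\<lambda>a. of_nat (Suc a) ^ l) :: real fps"
  let ?c = "\<lambda>j. of_nat (Stirling (Suc l) (Suc j) * fact j * ((k + j) choose j)) :: real"
  let ?E = "\<lambda>j. fps_exp 1 * (fps_exp 1 - 1) ^ j :: real fps"
  \<comment> \<open>The Stirling numbers of the first kind turn \<open>\<Sum>\<^sub>j [k, j] (a + 1)^j\<close> into the rising factorial
    of \<open>a + 1\<close>, which is \<open>k! C(a + k, k)\<close>.\<close>
  have rising: "(\<Sum>j\<le>k. fps_const (of_nat (stirling k j)) * ?A (l + j))
      = fps_const (fact k) * Abs_fps (\<lambda>a. of_nat ((a + k) choose k) * of_nat (Suc a) ^ l)"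
  proof (rule fps_ext)
    fix a
    have "(\<Sum>j\<le>k. of_nat (stirling k j) * of_nat (Suc a) ^ (l + j))
        = of_nat (Suc a) ^ l * (pochhammer (of_nat (Suc a)) k :: real)"
      unfolding stirling_pochhammer[symmetric] power_add
      by (simp add: sum_distrib_left ac_simps del: of_nat_Suc)
    also have "\<dots> = fact k * (of_nat ((a + k) choose k) * of_nat (Suc a) ^ l)"
      unfolding pochhammer_Suc_eq_fact_binomial by (simp only: ac_simps)
    finally show "fps_nth (\<Sum>j\<le>k. fps_const (of_nat (stirling k j)) * ?A (l + j)) a
      = fps_nth (fps_const (fact k) * Abs_fps (\<lambda>a. of_nat ((a + k) choose k) * of_nat (Suc a) ^ l)) a"
      by (simp add: fps_sum_nth del: of_nat_Suc)
  qed
  have minus_diff: "- int l - int j = - int (l + j)" for j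
    by simp
  have "sym_poly_bernoulli m l k = fact m *
     fps_nth (\<Sum>j\<le>k. fps_const (of_nat (stirling k j)) * poly_bernoulli_fps (- int (l + j)) (of_nat k)) m"
    unfolding sym_poly_bernoulli_def poly_bernoulli_def minus_diff
    by (simp add: fps_sum_nth sum_distrib_left mult.left_commute del: of_nat_add)
  also have "(\<Sum>j\<le>k. fps_const (of_nat (stirling k j)) * poly_bernoulli_fps (- int (l + j)) (of_nat k))
    = fps_exp (- of_nat k) * ((\<Sum>j\<le>k. fps_const (of_nat (stirling k j)) * ?A (l + j)) oo ?w)"
    unfolding poly_bernoulli_fps_nonpos
    by (simp add: fps_compose_sum_distrib fps_compose_mult_distrib sum_distrib_left ac_simps
        del: of_nat_Suc of_nat_add)
  also have "\<dots> = fps_const (fact k) * (\<Sum>j\<le>l. fps_const (?c j) * ?E j)"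
    unfolding rising fps_binomial_mult_power_eq_sum fps_exp_mult_compose_summand[symmetric, of _ k]
    by (simp add: fps_compose_sum_distrib fps_compose_mult_distrib sum_distrib_left ac_simps
        del: of_nat_Suc of_nat_add of_nat_mult power_Suc)
  also have "fact m * fps_nth \<dots> m = fact m * (fact k * (\<Sum>j\<le>l. ?c j * fps_nth (?E j) m))"
    by (simp only: fps_mult_left_const_nth fps_sum_nth)
  also have "\<dots> = fact k * (\<Sum>j\<le>l. ?c j * (fact m * fps_nth (?E j) m))"
    by (simp only: sum_distrib_left ac_simps)
  also have "\<dots> = fact k *
     (\<Sum>j\<le>l. weight k j * of_nat (Stirling (Suc l) (Suc j)) * of_nat (Stirling (Suc m) (Suc j)))"
    unfolding fps_exp_times_exp_minus_one_power_nth weight_def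
    by (simp add: ac_simps power2_eq_square del: Stirling.simps)
  finally show ?thesis .
qed

section \<open>Alternating convolutions of Stirling numbers\<close>

definition Stirling_conv :: "nat \<Rightarrow> nat \<Rightarrow> 'a::comm_ring_1" where
  "Stirling_conv n j = (\<Sum>l\<le>n. (-1) ^ l * of_nat (Stirling (Suc l) (Suc j)) *
     of_nat (Stirling (Suc (n - l)) (Suc j)))"

lemma Stirling_conv_eq_0: "n < j \<Longrightarrow> Stirling_conv n j = 0"
  unfolding Stirling_conv_def by (intro sum.neutral) (auto simp del: Stirling.simps)

lemma Stirling_conv_0: "Stirling_conv 0 j = (if j = 0 then 1 else 0)"
  by (cases j) (auto simp: Stirling_conv_def)

lemma Stirling_conv_1: "Stirling_conv (Suc 0) j = 0"
  by (simp add: Stirling_conv_def del: Stirling.simps)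

text \<open>
  The series \<open>U\<^sub>j = \<Sum>\<^sub>n S(n + 1, j + 1) X^n\<close> satisfies \<open>(1 - (j + 1) X) U\<^sub>j = X U\<^sub>j\<^sub>-\<^sub>1\<close>, and its
  reflection \<open>V\<^sub>j\<close> under \<open>X \<mapsto> - X\<close> satisfies \<open>(1 + (j + 1) X) V\<^sub>j = - X V\<^sub>j\<^sub>-\<^sub>1\<close>. Multiplying, one gets
  \<open>(1 - (j + 1)\<^sup>2 X\<^sup>2) V\<^sub>j U\<^sub>j = - X\<^sup>2 V\<^sub>j\<^sub>-\<^sub>1 U\<^sub>j\<^sub>-\<^sub>1\<close>, and the convolution is the coefficient sequence
  of \<open>V\<^sub>j U\<^sub>j\<close>.
\<close>

lemma Stirling_conv_Suc_Suc:
  "(Stirling_conv (Suc (Suc n)) j :: 'a::comm_ring_1) = of_nat (Suc j) ^ 2 * Stirling_conv n j -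
     (if j = 0 then 0 else Stirling_conv n (j - 1))"
proof -
  define U where "U j = Abs_fps (\<lambda>n. of_nat (Stirling (Suc n) (Suc j)) :: 'a)" for j
  define V where "V j = Abs_fps (\<lambda>n. (-1) ^ n * of_nat (Stirling (Suc n) (Suc j)) :: 'a)" for j
  define c where "c = fps_const (of_nat (Suc j) :: 'a)"
  \<comment> \<open>For \<open>j = 0\<close> the Stirling numbers are all 1, so \<open>U\<close> is the geometric series and the right-hand
    side of its equation is 1.\<close>
  define prevU where "prevU = (if j = 0 then 1 else fps_X * U (j - 1))"
  define prevV where "prevV = (if j = 0 then 1 else - fps_X * V (j - 1))"
  have conv: "Stirling_conv n j = fps_nth (V j * U j) n" for n j
    by (simp add: Stirling_conv_def U_def V_def fps_mult_nth atMost_atLeast0 del: Stirling.simps)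
  have recU: "U j = prevU + fps_X * (c * U j)"
  proof (rule fps_ext)
    fix n show "fps_nth (U j) n = fps_nth (prevU + fps_X * (c * U j)) n"
      by (cases n; cases j) (simp_all add: U_def prevU_def c_def algebra_simps)
  qed
  have recV: "V j = prevV - fps_X * (c * V j)"
  proof (rule fps_ext)
    fix n show "fps_nth (V j) n = fps_nth (prevV - fps_X * (c * V j)) n"
      by (cases n; cases j) (simp_all add: V_def prevV_def c_def algebra_simps)
  qed
  have c_square: "c\<^sup>2 = fps_const (of_nat (Suc j) ^ 2)"
    by (simp add: c_def fps_const_power)
  have "prevV * prevU = (V j + fps_X * (c * V j)) * (U j - fps_X * (c * U j))"
    using recU recV by (metis add_diff_cancel_right' diff_add_cancel)
  also have "\<dots> = V j * U j - c\<^sup>2 * (fps_X ^ 2 * (V j * U j))"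
    by (simp add: algebra_simps power2_eq_square)
  finally have "fps_nth (prevV * prevU) (Suc (Suc n)) =
      Stirling_conv (Suc (Suc n)) j - of_nat (Suc j) ^ 2 * Stirling_conv n j"
    by (simp add: conv c_square fps_X_power_mult_nth del: power_Suc of_nat_Suc)
  moreover have "fps_nth (prevV * prevU) (Suc (Suc n))
      = - (if j = 0 then 0 else Stirling_conv n (j - 1))"
  proof (cases j)
    case (Suc i)
    then have "prevV * prevU = - (fps_X ^ 2 * (V i * U i))"
      by (simp add: prevU_def prevV_def power2_eq_square algebra_simps)
    with Suc show ?thesis by (simp add: fps_X_power_mult_nth conv)
  qed (simp add: prevU_def prevV_def)
  ultimately show ?thesis by (simp add: algebra_simps)
qed

definition alt_sum :: "nat \<Rightarrow> nat \<Rightarrow> real" where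
  "alt_sum n k = (\<Sum>j\<le>n. weight k j * Stirling_conv n j)"

lemma sum_sym_poly_bernoulli_eq:
  "(\<Sum>l\<le>n. (-1) ^ l * sym_poly_bernoulli (n - l) l k) = fact k * alt_sum n k"
proof -
  \<comment> \<open>Extending the range of \<open>j\<close> from \<open>l\<close> to \<open>n\<close> adds only zeros and makes it independent of \<open>l\<close>,
    so that the two sums can be exchanged.\<close>
  have "(-1) ^ l * sym_poly_bernoulli (n - l) l k = (\<Sum>j\<le>n. fact k * (weight k j * 
     ((-1) ^ l * of_nat (Stirling (Suc l) (Suc j)) * of_nat (Stirling (Suc (n - l)) (Suc j)))))"
    if "l \<le> n" for l
  proof -
    have "(\<Sum>j\<le>l. weight k j * of_nat (Stirling (Suc l) (Suc j)) * of_nat (Stirling (Suc (n - l)) (Suc j)))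
      = (\<Sum>j\<le>n. weight k j * of_nat (Stirling (Suc l) (Suc j)) * of_nat (Stirling (Suc (n - l)) (Suc j)))"
      using that by (intro sum.mono_neutral_left) (auto simp del: Stirling.simps)
    then show ?thesis
      unfolding sym_poly_bernoulli_eq by (simp add: sum_distrib_left ac_simps del: Stirling.simps)
  qed
  then have "(\<Sum>l\<le>n. (-1) ^ l * sym_poly_bernoulli (n - l) l k)
    = (\<Sum>l\<le>n. \<Sum>j\<le>n. fact k * (weight k j * 
     ((-1) ^ l * of_nat (Stirling (Suc l) (Suc j)) * of_nat (Stirling (Suc (n - l)) (Suc j)))))"
    by (intro sum.cong) auto
  also have "\<dots> = fact k * alt_sum n k"
    unfolding alt_sum_def Stirling_conv_def sum_distrib_left by (rule sum.swap)
  finally show ?thesis .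
qed

lemma weight_Suc_right: "weight k (Suc j) = of_nat (Suc j) * of_nat (k + Suc j) * weight k j"
proof -
  have "Suc j * ((k + Suc j) choose Suc j) = (k + Suc j) * ((k + j) choose j)"
    using Suc_times_binomial_eq[of "k + j" j] by (simp only: mult.commute add_Suc_right)
  then have "of_nat (Suc j) * of_nat ((k + Suc j) choose Suc j)
      = (of_nat (k + Suc j) * of_nat ((k + j) choose j) :: real)"
    by (simp only: flip: of_nat_mult)
  then show ?thesis
    by (simp add: weight_def power2_eq_square ac_simps del: of_nat_Suc of_nat_add add_Suc_right binomial_Suc_Suc)
qed

lemma weight_Suc_left: "of_nat (Suc k) * weight (Suc k) j = of_nat (k + Suc j) * weight k j"
proof -
  have "Suc k * ((Suc k + j) choose j) = (k + Suc j) * ((k + j) choose j)"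
    using Suc_times_binomial_eq[of "k + j" k] binomial_symmetric[of j "k + j"]
      binomial_symmetric[of j "Suc k + j"] by (simp add: ac_simps)
  then have "of_nat (Suc k) * of_nat ((Suc k + j) choose j)
      = (of_nat (k + Suc j) * of_nat ((k + j) choose j) :: real)"
    by (simp only: flip: of_nat_mult)
  then show ?thesis
    by (simp add: weight_def del: of_nat_Suc of_nat_add add_Suc add_Suc_right)
qed

text \<open>
  After a shift of \<open>j\<close>, the recurrence of the convolution produces
  \<open>(j + 1)\<^sup>2 weight k j - weight k (j + 1) = - k (j + 1) weight k j\<close>. The factor \<open>j + 1\<close> is traded
  for a shift of \<open>k\<close> through \<open>(k + 1) weight (k + 1) j = (k + j + 1) weight k j\<close>.
\<close>

lemma alt_sum_Suc_Suc:
  "alt_sum (Suc (Suc n)) k =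
     - (of_nat k * ((of_nat k + 1) * alt_sum n (Suc k) - of_nat k * alt_sum n k))"
proof -
  let ?D = "Stirling_conv n :: nat \<Rightarrow> real"
  have "alt_sum (Suc (Suc n)) k = (\<Sum>j\<le>Suc (Suc n). weight k j * (of_nat (Suc j) ^ 2 * ?D j))
      - (\<Sum>j\<le>Suc (Suc n). weight k j * (if j = 0 then 0 else ?D (j - 1)))"
    unfolding alt_sum_def Stirling_conv_Suc_Suc by (simp only: right_diff_distrib sum_subtractf)
  also have "(\<Sum>j\<le>Suc (Suc n). weight k j * (of_nat (Suc j) ^ 2 * ?D j))
      = (\<Sum>j\<le>n. of_nat (Suc j) ^ 2 * weight k j * ?D j)"
    by (simp add: Stirling_conv_eq_0 ac_simps)
  also have "(\<Sum>j\<le>Suc (Suc n). weight k j * (if j = 0 then 0 else ?D (j - 1)))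
      = (\<Sum>j\<le>n. weight k (Suc j) * ?D j)"
    by (subst sum.atMost_Suc_shift) (simp add: Stirling_conv_eq_0)
  also have "(\<Sum>j\<le>n. of_nat (Suc j) ^ 2 * weight k j * ?D j) - (\<Sum>j\<le>n. weight k (Suc j) * ?D j)
      = (\<Sum>j\<le>n. - (of_nat k * ((of_nat (Suc k) * weight (Suc k) j) * ?D j - of_nat k * weight k j * ?D j)))"
    unfolding weight_Suc_left weight_Suc_right sum_subtractf[symmetric]
    by (intro sum.cong) (simp_all add: algebra_simps power2_eq_square)
  also have "\<dots> = - (of_nat k * ((of_nat k + 1) * alt_sum n (Suc k) - of_nat k * alt_sum n k))"
    by (simp add: alt_sum_def sum_negf sum_subtractf sum_distrib_left algebra_simps)
  finally show ?thesis .
qed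

section \<open>The recurrence of the Dumont-Foata polynomials\<close>

lemma finite_pistols: "finite (pistols n)"
  unfolding pistols_def
  by (rule finite_subset[of _ "{1..n} \<rightarrow>\<^sub>E {v \<in> {1..n}. even v}"]) (auto intro: finite_PiE)

definition max_fiber :: "nat \<Rightarrow> (nat \<Rightarrow> nat) \<Rightarrow> nat set" where
  "max_fiber n p = {x \<in> {1..n}. p x = n}"

lemma pistol_le:
  assumes "p \<in> pistols n" "x \<in> {1..n}"
  shows "p x \<in> {1..n}" "even (p x)" "x \<le> p x"
  using assms unfolding pistols_def by (fastforce dest: PiE_mem)+

lemma max_fiber_eq_insert:
  assumes "p \<in> pistols n" "0 < n"
  shows "max_fiber n p = insert n (maximal_points n p)"
  using pistol_le[OF assms(1), of n] assms(2)
  by (auto simp: max_fiber_def maximal_points_def)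

text \<open>
  The following maps are mutually inverse: a pistol of size \<open>n + 2\<close> is capped at \<open>n\<close>, and the
  set of points \<open>x \<le> n\<close> that lose the value \<open>n + 2\<close> is recorded; conversely, a set of points is lifted
  from the value \<open>n\<close> to \<open>n + 2\<close>. The two new points \<open>n + 1\<close> and \<open>n + 2\<close> can only be mapped
  to \<open>n + 2\<close>.
\<close>

definition extend_pistol :: "nat \<Rightarrow> (nat \<Rightarrow> nat) \<Rightarrow> nat set \<Rightarrow> nat \<Rightarrow> nat" where
  "extend_pistol n q A = (\<lambda>x\<in>{1..n + 2}. if x \<in> A \<or> n < x then n + 2 else q x)"

definition restrict_pistol :: "nat \<Rightarrow> (nat \<Rightarrow> nat) \<Rightarrow> nat \<Rightarrow> nat" where
  "restrict_pistol n p = (\<lambda>x\<in>{1..n}. min (p x) n)"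

definition lifted_points :: "nat \<Rightarrow> (nat \<Rightarrow> nat) \<Rightarrow> nat set" where
  "lifted_points n p = {x \<in> {1..n}. p x = n + 2}"

text \<open>
  A point of the fiber outside \<open>A\<close> keeps the value \<open>n\<close> in the image; this is where
  properness of the subset enters.
\<close>

lemma extend_pistol_in_pistols:
  assumes n: "even n" "0 < n" and q: "q \<in> pistols n" and A: "A \<subset> max_fiber n q"
  shows "extend_pistol n q A \<in> pistols (n + 2)"
proof -
  let ?p = "extend_pistol n q A"
  have new: "?p x = n + 2" if "x \<in> {1..n + 2}" "x \<in> A \<or> n < x" for x
    using that by (simp add: extend_pistol_def)
  have old: "?p x = q x" if "x \<in> {1..n}" "x \<notin> A" for x
    using that by (simp add: extend_pistol_def)
  have bounds: "?p x \<in> {v \<in> {1..n + 2}. even v} \<and> x \<le> ?p x" if x: "x \<in> {1..n + 2}" for x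
  proof (cases "x \<in> A \<or> n < x")
    case True
    from new[OF x this] n x show ?thesis by simp
  next
    case False
    with x have x': "x \<in> {1..n}" "x \<notin> A" by auto
    from old[OF x'] pistol_le[OF q x'(1)] show ?thesis by auto
  qed
  have "v \<in> ?p ` {1..n + 2}" if v: "v \<in> {1..n + 2}" "even v" for v
  proof -
    have "v \<noteq> n + 1" using v n by auto
    with v have "v = n + 2 \<or> v = n \<or> v < n" by auto
    then have "\<exists>x\<in>{1..n + 2}. ?p x = v"
    proof (elim disjE)
      assume "v = n + 2"
      with new[of "n + 2"] show ?thesis by (intro bexI[of _ "n + 2"]) simp_all
    next
      assume "v = n"
      moreover from A obtain x where "x \<in> max_fiber n q" "x \<notin> A" by blast
      moreover from this have "x \<in> {1..n}" "q x = n" by (simp_all add: max_fiber_def)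
      ultimately show ?thesis using old[of x] by (intro bexI[of _ x]) simp_all
    next
      assume less: "v < n"
      with v have "v \<in> {v \<in> {1..n}. even v}" by simp
      then have "v \<in> q ` {1..n}" using q unfolding pistols_def by blast
      then obtain x where x: "x \<in> {1..n}" "q x = v" by blast
      with less have "x \<notin> max_fiber n q" by (simp add: max_fiber_def)
      with A have "x \<notin> A" by blast
      with old[OF x(1)] x show ?thesis by (intro bexI[of _ x]) simp_all
    qed
    then show ?thesis by blast
  qed
  with bounds have "?p ` {1..n + 2} = {v \<in> {1..n + 2}. even v}"
    by blast
  moreover have "?p \<in> {1..n + 2} \<rightarrow>\<^sub>E {v \<in> {1..n + 2}. even v}"
  proof (rule PiE_I)
    show "?p x \<in> {v \<in> {1..n + 2}. even v}" if "x \<in> {1..n + 2}" for x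
      using bounds[OF that] by blast
    show "?p x = undefined" if "x \<notin> {1..n + 2}" for x
      using that unfolding extend_pistol_def by (simp only: restrict_apply if_False)
  qed
  ultimately show ?thesis
    using bounds unfolding pistols_def by blast
qed

lemma pistol_value_cases:
  assumes "p \<in> pistols (n + 2)" "even n" "x \<in> {1..n + 2}"
  shows "p x \<le> n \<or> p x = n + 2"
  using pistol_le[OF assms(1,3)] assms(2)
  by (metis One_nat_def add_2_eq_Suc' atLeastAtMost_iff even_Suc le_Suc_eq)

text \<open>
  A value \<open>v \<le> n\<close> of the larger pistol is attained at some \<open>x \<le> v\<close>, hence at a point that survives the
  restriction. For \<open>v = n\<close> such a point is not lifted, so the lifted points miss part of the fiber.
\<close>

lemma restrict_pistol_in_pistols:
  assumes n: "even n" "0 < n" and p: "p \<in> pistols (n + 2)"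
  shows "restrict_pistol n p \<in> pistols n"
    and "lifted_points n p \<subset> max_fiber n (restrict_pistol n p)"
proof -
  let ?q = "restrict_pistol n p"
  have preimage: "\<exists>x\<in>{1..n}. p x = v" if v: "v \<in> {1..n}" "even v" for v
  proof -
    have "v \<in> {v \<in> {1..n + 2}. even v}" using v by auto
    then have "v \<in> p ` {1..n + 2}" using p unfolding pistols_def by blast
    then obtain x where x: "x \<in> {1..n + 2}" "p x = v" by blast
    with pistol_le(3)[OF p x(1)] v show ?thesis by auto
  qed
  have bounds: "?q x \<in> {v \<in> {1..n}. even v} \<and> x \<le> ?q x" if "x \<in> {1..n}" for x
    using that n pistol_le[OF p, of x] by (auto simp: restrict_pistol_def min_def)
  have "v \<in> ?q ` {1..n}" if v: "v \<in> {1..n}" "even v" for v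
  proof -
    from preimage[OF v] obtain x where "x \<in> {1..n}" "p x = v" by blast
    with v show ?thesis by (intro image_eqI[of _ _ x]) (auto simp: restrict_pistol_def)
  qed
  then have "?q ` {1..n} = {v \<in> {1..n}. even v}"
    using bounds by (intro equalityI subsetI) auto
  moreover have "?q \<in> {1..n} \<rightarrow>\<^sub>E {v \<in> {1..n}. even v}"
    using bounds by (intro PiE_I) (auto simp: restrict_pistol_def)
  ultimately show "?q \<in> pistols n"
    using bounds unfolding pistols_def by blast
  from preimage[of n] n obtain x where "x \<in> {1..n}" "p x = n" by auto
  then have "x \<in> max_fiber n ?q - lifted_points n p"
    by (auto simp: max_fiber_def lifted_points_def restrict_pistol_def)
  moreover have "lifted_points n p \<subseteq> max_fiber n ?q"
    by (auto simp: max_fiber_def lifted_points_def restrict_pistol_def)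
  ultimately show "lifted_points n p \<subset> max_fiber n ?q" by blast
qed

lemma extend_restrict_pistol:
  assumes "even n" "0 < n" "p \<in> pistols (n + 2)"
  shows "extend_pistol n (restrict_pistol n p) (lifted_points n p) = p"
proof
  fix x
  show "extend_pistol n (restrict_pistol n p) (lifted_points n p) x = p x"
  proof (cases "x \<in> {1..n + 2}")
    case True
    with pistol_le[OF assms(3) True] pistol_value_cases[OF assms(3,1) True] show ?thesis
      by (auto simp: extend_pistol_def restrict_pistol_def lifted_points_def)
  next
    case False
    moreover have "p x = undefined"
      using assms(3) False unfolding pistols_def by (auto dest: PiE_arb)
    ultimately show ?thesis by (auto simp: extend_pistol_def)
  qed
qed

lemma lifted_points_extend_pistol:
  assumes "q \<in> pistols n" "A \<subset> max_fiber n q"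
  shows "lifted_points n (extend_pistol n q A) = A"
proof -
  have "q x \<noteq> n + 2" if "x \<in> {1..n}" for x
    using pistol_le[OF assms(1) that] by auto
  with assms(2) show ?thesis
    by (auto simp: lifted_points_def extend_pistol_def max_fiber_def split: if_splits)
qed

lemma restrict_extend_pistol:
  assumes "q \<in> pistols n" "A \<subset> max_fiber n q"
  shows "restrict_pistol n (extend_pistol n q A) = q"
proof
  fix x
  show "restrict_pistol n (extend_pistol n q A) x = q x"
  proof (cases "x \<in> {1..n}")
    case True
    with pistol_le[OF assms(1) True] assms(2) show ?thesis
      by (auto simp: extend_pistol_def restrict_pistol_def max_fiber_def)
  next
    case False
    moreover have "q x = undefined"
      using assms(1) False unfolding pistols_def by (auto dest: PiE_arb)
    ultimately show ?thesis by (auto simp: restrict_pistol_def)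
  qed
qed

lemma card_maximal_points_pistol:
  assumes "even n" "p \<in> pistols (n + 2)"
  shows "card (maximal_points (n + 2) p) = Suc (card (lifted_points n p))"
proof -
  \<comment> \<open>The argument \<open>n + 1\<close> is always a maximal point; \<open>n + 2\<close> never counts as one.\<close>
  have "p (n + 1) = n + 2"
    using pistol_value_cases[OF assms(2,1), of "n + 1"] pistol_le(3)[OF assms(2), of "n + 1"] by auto
  then have "maximal_points (n + 2) p = insert (n + 1) (lifted_points n p)"
    by (auto simp: maximal_points_def lifted_points_def le_Suc_eq)
  moreover have "n + 1 \<notin> lifted_points n p" "finite (lifted_points n p)"
    by (auto simp: lifted_points_def)
  ultimately show ?thesis by simp
qed

lemma finite_psubsets: "finite S \<Longrightarrow> finite {A. A \<subset> S}"
  by (rule finite_subset[of _ "Pow S"]) auto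

lemma sum_power_card_psubsets:
  fixes z :: "'a::comm_ring_1"
  assumes "finite S"
  shows "(\<Sum>A | A \<subset> S. z ^ card A) = (z + 1) ^ card S - z ^ card S"
proof -
  have "(\<Sum>A\<in>Pow S. z ^ card A) = (\<Sum>A\<in>Pow S. (\<Prod>x\<in>A. z) * (\<Prod>x\<in>S - A. 1))"
    by simp
  also have "\<dots> = (z + 1) ^ card S"
    using prod_add[OF assms, of "\<lambda>_. z" "\<lambda>_. 1"] by simp
  finally have "(\<Sum>A\<in>Pow S. z ^ card A) = (z + 1) ^ card S" .
  moreover have "Pow S = insert S {A. A \<subset> S}" by auto
  moreover have "finite {A. A \<subset> S}"
    using assms by (rule finite_psubsets)
  ultimately show ?thesis by (simp add: algebra_simps)
qed

text \<open>
  The fiber of \<open>q\<close> over \<open>n\<close> has one element more than the set of maximal points, namely \<open>n\<close> itself.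
  So summing \<open>z\<close> to the cardinality over its proper subsets gives
  \<open>(z + 1)^(m + 1) - z^(m + 1)\<close>, where \<open>m\<close> counts the maximal points of \<open>q\<close>; the outer factor \<open>z\<close> is
  the contribution of the point \<open>n + 1\<close>.
\<close>

lemma sum_pistols_recurrence:
  fixes z :: "'a::comm_ring_1"
  assumes n: "even n" "0 < n"
  shows "(\<Sum>p\<in>pistols (n + 2). z ^ card (maximal_points (n + 2) p)) =
    z * ((z + 1) * (\<Sum>p\<in>pistols n. (z + 1) ^ card (maximal_points n p))
         - z * (\<Sum>p\<in>pistols n. z ^ card (maximal_points n p)))"
proof -
  have card_fiber: "card (max_fiber n q) = Suc (card (maximal_points n q))" if "q \<in> pistols n" for q
    using max_fiber_eq_insert[OF that n(2)] by (simp add: maximal_points_def)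
  have finite_fiber: "finite (max_fiber n q)" for q
    by (simp add: max_fiber_def)
  have "(\<Sum>p\<in>pistols (n + 2). z ^ card (maximal_points (n + 2) p))
    = (\<Sum>(q, A)\<in>(SIGMA q:pistols n. {A. A \<subset> max_fiber n q}). z ^ Suc (card A))"
  proof (rule sum.reindex_bij_witness[of _ "\<lambda>(q, A). extend_pistol n q A"
        "\<lambda>p. (restrict_pistol n p, lifted_points n p)"])
    fix p assume p: "p \<in> pistols (n + 2)"
    show "(case (restrict_pistol n p, lifted_points n p) of (q, A) \<Rightarrow> extend_pistol n q A) = p"
      using extend_restrict_pistol[OF n p] by simp
    show "(restrict_pistol n p, lifted_points n p)
        \<in> (SIGMA q:pistols n. {A. A \<subset> max_fiber n q})"
      using restrict_pistol_in_pistols[OF n p] by blast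
    show "(case (restrict_pistol n p, lifted_points n p) of (q, A) \<Rightarrow> z ^ Suc (card A))
        = z ^ card (maximal_points (n + 2) p)"
      using card_maximal_points_pistol[OF n(1) p] by simp
  next
    fix qA assume "qA \<in> (SIGMA q:pistols n. {A. A \<subset> max_fiber n q})"
    then obtain q A where qA: "qA = (q, A)" and q: "q \<in> pistols n" and A: "A \<subset> max_fiber n q"
      by blast
    show "(restrict_pistol n (case qA of (q, A) \<Rightarrow> extend_pistol n q A),
        lifted_points n (case qA of (q, A) \<Rightarrow> extend_pistol n q A)) = qA"
      using restrict_extend_pistol[OF q A] lifted_points_extend_pistol[OF q A] qA by simp
    show "(case qA of (q, A) \<Rightarrow> extend_pistol n q A) \<in> pistols (n + 2)"
      using extend_pistol_in_pistols[OF n q A] qA by simp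
  qed
  also have "\<dots> = (\<Sum>q\<in>pistols n. z * (\<Sum>A | A \<subset> max_fiber n q. z ^ card A))"
    using finite_fiber
    by (subst sum.Sigma[symmetric]) (auto simp: finite_pistols finite_psubsets sum_distrib_left)
  also have "\<dots> = (\<Sum>q\<in>pistols n. z * ((z + 1) * (z + 1) ^ card (maximal_points n q)
      - z * z ^ card (maximal_points n q)))"
    by (intro sum.cong) (simp_all add: sum_power_card_psubsets finite_fiber card_fiber)
  finally show ?thesis
    by (simp add: sum_subtractf sum_distrib_left right_diff_distrib)
qed

lemma pistols_2: "pistols 2 = {\<lambda>x\<in>{1..2}. 2}"
proof -
  have evens: "{v \<in> {1..2::nat}. even v} = {2}"
    by (auto simp: le_Suc_eq numeral_2_eq_2)
  have maps: "{1..2} \<rightarrow>\<^sub>E {2} = {\<lambda>x\<in>{1..2::nat}. 2::nat}"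
    by (intro PiE_eq_singleton[THEN iffD2]) simp
  have "(\<lambda>x\<in>{1..2}. 2) ` {1..2::nat} = {2::nat}"
    by (subst image_restrict_eq) (simp add: image_constant_conv)
  then show ?thesis
    unfolding pistols_def evens maps by auto
qed

text \<open>
  The bijection needs a nonempty fiber over \<open>n\<close>, so the step from 0 to 2 is verified separately;
  for odd \<open>n\<close> both sides vanish.
\<close>

lemma dumont_foata_Suc_Suc:
  "dumont_foata (Suc (Suc n)) 1 1 z = z * ((z + 1) * dumont_foata n 1 1 (z + 1) - z * dumont_foata n 1 1 z)"
proof (cases "n = 0")
  case True
  have "maximal_points 2 (\<lambda>x\<in>{1..2}. 2) = {1}"
    by (auto simp: maximal_points_def)
  then show ?thesis
    using True by (simp add: dumont_foata_def pistols_2 numeral_2_eq_2[symmetric])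
next
  case False
  then show ?thesis
    using sum_pistols_recurrence[of n z] by (simp add: dumont_foata_def)
qed

section \<open>Comparison of the two recurrences\<close>

lemma alt_sum_eq_dumont_foata:
  "alt_sum n k = (-1) ^ (n div 2) * dumont_foata n 1 1 (of_nat k)"
proof (induction n arbitrary: k rule: induct_nat_012)
  case 0
  show ?case by (simp add: alt_sum_def Stirling_conv_0 weight_def dumont_foata_def)
next
  case 1
  show ?case by (simp add: alt_sum_def Stirling_conv_1 dumont_foata_def)
next
  case (ge2 n)
  show ?case
    unfolding alt_sum_Suc_Suc ge2.IH(1) dumont_foata_Suc_Suc by (simp add: algebra_simps)
qed

theorem theorem1p1:
  fixes n k :: nat
  shows "(\<Sum>l\<le>n. (-1) ^ l * sym_poly_bernoulli (n - l) l k)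
           = fact k * (-1) ^ (n div 2) * dumont_foata n 1 1 (of_nat k)
       \<and> (odd n \<longrightarrow>
           (\<Sum>l\<le>n. (-1) ^ l * sym_poly_bernoulli (n - l) l k) = 0
         \<and> fact k * (-1) ^ (n div 2) * dumont_foata n 1 1 (of_nat k) = (0::real))"
proof -
  have "(\<Sum>l\<le>n. (-1) ^ l * sym_poly_bernoulli (n - l) l k)
      = fact k * (-1) ^ (n div 2) * dumont_foata n 1 1 (of_nat k)"
    unfolding sum_sym_poly_bernoulli_eq alt_sum_eq_dumont_foata by simp
  moreover have "dumont_foata n 1 1 (of_nat k) = (0::real)" if "odd n"
    using that odd_pos[OF that] by (simp add: dumont_foata_def)
  ultimately show ?thesis by simp
qed

end
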